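(* Let $a:\mathbb R^2\to[0,1]$ be continuous, non-trivial (not identically zero), and periodic. Then $a$ satisfies the comb GCC. In particular, there exist $\eta,T_0>0$ such that the following two statements hold for all $\theta=(P,Q)/T$ where $P,Q\in\mathbb Z$, $\gcd(P,Q)=1$, $T=\sqrt{P^2+Q^2}$: (1) if $T\ge T_0$, then $a$ satisfies the $(T+2,\eta)$ GCC in direction $\theta$; (2) if $T<T_0$, then $a$ satisfies the $(2T+4,1/T,\eta)$ comb GCC in direction $\theta$.
   Context: For $\theta\in\mathbb S^1$ let $\theta a=a\circ R_\theta$, where $R_\theta$ is the rotation of $\mathbb R^2$ sending $(0,1)$ to $\theta$. For $M>0$ let $$a_{\theta,M}(x)=\inf_{t\in\mathbb R}\frac1M\int_t^{t+M}\theta a(x,y)\,dy,\qquad x\in\mathbb R.$$ $a$ satisfies the $(M,\eta)$ GCC (geometric control condition) in direction $\theta$ if $a_{\theta,M}(x)\ge\eta$ for all $x\in\mathbb R$. $a$ satisfies the $(M,L,\eta)$ comb GCC in direction $\theta$ if $a_{\theta,M}$ is $(L,\eta)$ relatively dense, i.e. $\inf_{x\in\mathbb R}\frac1L\int_x^{x+L}a_{\theta,M}(s)\,ds\ge\eta$. Fix $L,\eta>0$. For $\rho>0$ and $\lambda\ge1$, $a$ has a $(\rho,\lambda)$ effective covering if there exist a set $\Theta\subset\mathbb S^1$ and, for each $\theta\in\Theta$, an arc width $\varepsilon_\theta>0$ and a length $M_\theta>0$ such that: $\mathbb S^1\subset\bigcup_{\theta\in\Theta}\{\phi\in\mathbb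 S^1:|\phi-\theta|\le\varepsilon_\theta\}$; and for each $\theta\in\Theta$, $a$ satisfies the $(M_\theta,L,\eta)$ comb GCC in direction $\theta$ with $\varepsilon_\theta M_\theta+(\varepsilon_\theta\lambda)^{-1}<\rho$. $a$ satisfies the comb GCC if (for some fixed $L,\eta>0$, independent of $\rho$ and $\lambda$) for each $\rho>0$ there exists $\lambda_0\ge1$ such that for each $\lambda\ge\lambda_0$, $a$ has a $(\rho,\lambda)$ effective covering. *)

theory Defs
  imports "HOL-Analysis.Analysis"
begin

definition rot_to :: "real^2 \<Rightarrow> real^2^2" where
  "rot_to \<theta> = vector [vector [\<theta>$2, \<theta>$1], vector [- \<theta>$1, \<theta>$2]]"

lemma rotation_matrix_rot_to:
  assumes "\<theta> \<in> sphere 0 1"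
  shows "rotation_matrix (rot_to \<theta>)" and "rot_to \<theta> *v vector [0, 1] = \<theta>"
proof -
  have n: "\<theta>$1 * \<theta>$1 + \<theta>$2 * \<theta>$2 = 1"
    using assms by (simp add: norm_eq_1 inner_vec_def sum_2)
  show "rotation_matrix (rot_to \<theta>)"
    unfolding rotation_matrix_def orthogonal_matrix rot_to_def using n
    by (simp add: det_2 vec_eq_iff forall_2 matrix_matrix_mult_def transpose_def mat_def sum_2 add.commute)
  show "rot_to \<theta> *v vector [0, 1] = \<theta>"
    by (simp add: rot_to_def vec_eq_iff forall_2 matrix_vector_mult_def sum_2)
qed

lemma rot_to_unique:
  assumes "rotation_matrix A" and "A *v vector [0, 1] = \<theta>"
  shows "A = rot_to \<theta>"
proof -
  have c: "\<theta>$1 = A$1$2" "\<theta>$2 = A$2$2"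
    using assms(2) by (auto simp: vec_eq_iff forall_2 matrix_vector_mult_def sum_2)
  have o: "A$1$1 * A$1$1 + A$2$1 * A$2$1 = 1" "A$1$2 * A$1$2 + A$2$2 * A$2$2 = 1"
    and d: "A$1$1 * A$2$2 - A$1$2 * A$2$1 = 1"
    using assms(1)
    by (auto simp: rotation_matrix_def orthogonal_matrix det_2 vec_eq_iff forall_2
        matrix_matrix_mult_def transpose_def mat_def sum_2)
  have "(A$1$1 - A$2$2)\<^sup>2 + (A$2$1 + A$1$2)\<^sup>2 = 0"
    using o d unfolding power2_eq_square by (simp add: algebra_simps)
  then have "A$1$1 = A$2$2" "A$2$1 = - A$1$2"
    by (auto simp: sum_power2_eq_zero_iff)
  then show ?thesis
    using c by (simp add: rot_to_def vec_eq_iff forall_2)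
qed

definition rotated :: "real^2 \<Rightarrow> (real^2 \<Rightarrow> real) \<Rightarrow> real \<Rightarrow> real \<Rightarrow> real" where
  "rotated \<theta> a x y = a (rot_to \<theta> *v vector [x, y])"

text \<open>The infima below are taken in the conditionally complete order of the reals, so they have
  their usual meaning only for families bounded below, e.g. for nonnegative \<open>a\<close>.\<close>

definition dir_avg :: "real^2 \<Rightarrow> real \<Rightarrow> (real^2 \<Rightarrow> real) \<Rightarrow> real \<Rightarrow> real" where
  "dir_avg \<theta> M a x = (INF t. 1 / M * (LBINT y:{t..t + M}. rotated \<theta> a x y))"

definition gcc :: "real \<Rightarrow> real \<Rightarrow> real^2 \<Rightarrow> (real^2 \<Rightarrow> real) \<Rightarrow> bool" where
  "gcc M \<eta> \<theta> a \<longleftrightarrow> (\<forall>x. dir_avg \<theta> M a x \<ge> \<eta>)"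

definition relatively_dense :: "real \<Rightarrow> real \<Rightarrow> (real \<Rightarrow> real) \<Rightarrow> bool" where
  "relatively_dense L \<eta> f \<longleftrightarrow> (INF x. 1 / L * (LBINT s:{x..x + L}. f s)) \<ge> \<eta>"

definition comb_gcc_dir :: "real \<Rightarrow> real \<Rightarrow> real \<Rightarrow> real^2 \<Rightarrow> (real^2 \<Rightarrow> real) \<Rightarrow> bool" where
  "comb_gcc_dir M L \<eta> \<theta> a \<longleftrightarrow> relatively_dense L \<eta> (dir_avg \<theta> M a)"

definition effective_covering ::
    "real \<Rightarrow> real \<Rightarrow> real \<Rightarrow> real \<Rightarrow> (real^2 \<Rightarrow> real) \<Rightarrow> bool" where
  "effective_covering L \<eta> \<rho> lam a \<longleftrightarrow>
     (\<exists>\<Theta> \<subseteq> sphere 0 1. \<exists>\<epsilon> M :: real^2 \<Rightarrow> real.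
        (\<forall>\<theta>\<in>\<Theta>. \<epsilon> \<theta> > 0 \<and> M \<theta> > 0) \<and>
        sphere 0 1 \<subseteq> (\<Union>\<theta>\<in>\<Theta>. {\<phi> \<in> sphere 0 1. norm (\<phi> - \<theta>) \<le> \<epsilon> \<theta>}) \<and>
        (\<forall>\<theta>\<in>\<Theta>. comb_gcc_dir (M \<theta>) L \<eta> \<theta> a \<and> \<epsilon> \<theta> * M \<theta> + inverse (\<epsilon> \<theta> * lam) < \<rho>))"

definition comb_gcc :: "(real^2 \<Rightarrow> real) \<Rightarrow> bool" where
  "comb_gcc a \<longleftrightarrow>
     (\<exists>L>0. \<exists>\<eta>>0. \<forall>\<rho>>0. \<exists>lam0\<ge>1. \<forall>lam\<ge>lam0. effective_covering L \<eta> \<rho> lam a)"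

text \<open>Periodic means periodic with respect to the standard lattice of integer vectors.\<close>

definition periodic :: "(real^2 \<Rightarrow> real) \<Rightarrow> bool" where
  "periodic a \<longleftrightarrow> (\<forall>x k. (\<forall>i. k$i \<in> \<int>) \<longrightarrow> a (x + k) = a x)"

end

(* Along a rational direction (P,Q)/T every line is T-periodic, and by Bezout the mass of one period
   is a 1/T-periodic function F of the line. Every rotated square of side 2 carries mass at least
   some kappa > 0, so the average of F is at least of order kappa T, uniformly in the direction.
   For T < T0 averaging F over 1/T gives the comb condition; for T large F is nearly constant by
   uniform continuity, so it is everywhere of order T. For the covering, averaging F over length 2
   already works for all T, and by Dirichlet's theorem every direction is within 2/(N T) of a
   rational one with T <= 3 N; first N and then lambda are chosen large. *)

theory Submission
  imports Defs "HOL-Library.Periodic_Fun"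
begin

section \<open>Integrals of periodic functions\<close>

text \<open>Shift the window by whole periods so that it starts at \<open>s\<close> in [0, p], then
  split it at p: the overhang beyond p is a translate of the missing piece [0, s].\<close>

lemma integral_periodic:
  fixes g :: "real \<Rightarrow> real"
  assumes g: "continuous_on UNIV g" and per: "\<And>y. g (y + p) = g y" and p: "p > 0"
  shows "integral {t..t+p} g = integral {0..p} g"
proof -
  interpret periodic_fun_simple g p by standard (rule per)
  have int: "g integrable_on {u..v}" for u v
    by (intro integrable_continuous_real continuous_on_subset[OF g]) auto
  define s where "s = t - of_int \<lfloor>t / p\<rfloor> * p"
  have s: "0 \<le> s" "s \<le> p"
    using p floor_divide_lower[OF p, of t] floor_divide_upper[OF p, of t]
    by (auto simp: s_def algebra_simps)
  have "integral {t..t+p} g = integral {t - of_int \<lfloor>t / p\<rfloor> * p..t + p - of_int \<lfloor>t / p\<rfloor> * p} g"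
    using integral_shift_real_ivl[of t "of_int \<lfloor>t / p\<rfloor> * p" "t + p" g] by (simp add: plus_of_int)
  also have "\<dots> = integral {s..s+p} g"
    by (simp add: s_def algebra_simps)
  also have "\<dots> = integral {s..p} g + integral {p..s+p} g"
    using s p int by (intro Henstock_Kurzweil_Integration.integral_combine[symmetric]) auto
  also have "integral {p..s+p} g = integral {0..s} g"
    using integral_shift_real_ivl[of p p "s + p" g] by (simp add: per)
  also have "integral {s..p} g + integral {0..s} g = integral {0..p} g"
    using s Henstock_Kurzweil_Integration.integral_combine[OF s int] by simp
  finally show ?thesis .
qed

lemma integral_periods:
  fixes g :: "real \<Rightarrow> real"
  assumes g: "continuous_on UNIV g" and per: "\<And>y. g (y + p) = g y" and p: "p > 0"
  shows "integral {t..t + real n * p} g = real n * integral {0..p} g"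
proof (induction n)
  case (Suc n)
  have "integral {t..t + real (Suc n) * p} g
      = integral {t..t + real n * p} g + integral {t + real n * p..(t + real n * p) + p} g"
    using p by (subst Henstock_Kurzweil_Integration.integral_combine)
      (auto intro!: integrable_continuous_real continuous_on_subset[OF g] simp: algebra_simps)
  then show ?case
    using Suc integral_periodic[OF assms, of "t + real n * p"] by (simp add: algebra_simps)
qed auto

text \<open>The definitions use Lebesgue integrals; the estimates below shift, split and compare
  \<open>integral\<close> over intervals.\<close>

lemma LBINT_eq_integral:
  fixes f :: "real \<Rightarrow> real"
  assumes "continuous_on UNIV f"
  shows "(LBINT y:{u..v}. f y) = integral {u..v} f"
  by (intro set_borel_integral_eq_integral borel_integrable_atLeastAtMost'
      continuous_on_subset[OF assms]) auto

lemma integral_subinterval_ge: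
  fixes f :: "real \<Rightarrow> real"
  assumes f: "continuous_on UNIV f" "\<And>x. f x \<ge> 0"
    and sub: "u \<le> r" "r \<le> s" "s \<le> v" and c: "\<And>x. x \<in> {r..s} \<Longrightarrow> f x \<ge> c"
  shows "integral {u..v} f \<ge> c * (s - r)"
proof -
  have int: "f integrable_on {p..q}" for p q
    by (intro integrable_continuous_real continuous_on_subset[OF f(1)]) auto
  have "c * (s - r) = integral {r..s} (\<lambda>_. c)"
    using sub by simp
  also have "\<dots> \<le> integral {r..s} f"
    using c int by (intro integral_le) auto
  also have "\<dots> \<le> integral {u..v} f"
    using sub int f(2) by (intro integral_subset_le) auto
  finally show ?thesis .
qed

lemma norm_le_sum_abs_2: "norm (x :: real^2) \<le> \<bar>x$1\<bar> + \<bar>x$2\<bar>"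
  using norm_le_l1_cart[of x] by (simp add: sum_2)

section \<open>Rotated coordinates\<close>

text \<open>The image of (1, 0) under \<open>rot_to \<theta>\<close>, so x and y in
  \<open>rotated\<close> are coordinates along \<open>perp \<theta>\<close> and \<theta>.\<close>

definition perp :: "real^2 \<Rightarrow> real^2" where
  "perp \<theta> = vector [\<theta>$2, - \<theta>$1]"

lemma rotated_eq: "rotated \<theta> a x y = a (x *\<^sub>R perp \<theta> + y *\<^sub>R \<theta>)"
proof -
  have "rot_to \<theta> *v vector [x, y] = x *\<^sub>R perp \<theta> + y *\<^sub>R \<theta>"
    by (simp add: rot_to_def perp_def vec_eq_iff forall_2 matrix_vector_mult_def sum_2 algebra_simps)
  then show ?thesis by (simp add: rotated_def)
qed

lemma norm_perp [simp]: "norm (perp \<theta>) = norm \<theta>"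
  by (simp add: perp_def norm_vec_def L2_set_def sum_2 add.commute)

lemma perp_expansion:
  assumes "norm \<theta> = 1"
  shows "(k \<bullet> perp \<theta>) *\<^sub>R perp \<theta> + (k \<bullet> \<theta>) *\<^sub>R \<theta> = k"
proof -
  have n: "\<theta>$1 * \<theta>$1 + \<theta>$2 * \<theta>$2 = 1"
    using assms by (simp add: norm_eq_1 inner_vec_def sum_2)
  have "k$1 * (\<theta>$1 * \<theta>$1 + \<theta>$2 * \<theta>$2) = k$1" "k$2 * (\<theta>$1 * \<theta>$1 + \<theta>$2 * \<theta>$2) = k$2"
    using n by auto
  then show ?thesis
    by (simp add: perp_def vec_eq_iff forall_2 inner_vec_def sum_2 algebra_simps)
qed

section \<open>Uniform continuity and mass bounds for a periodic density\<close>

locale periodic_density =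
  fixes a :: "real^2 \<Rightarrow> real"
  assumes cont: "continuous_on UNIV a" and nonneg: "a z \<ge> 0"
    and nontrivial: "\<exists>z. a z \<noteq> 0" and per: "periodic a"
begin

lemma a_plus: "(\<And>i. k$i \<in> \<int>) \<Longrightarrow> a (z + k) = a z"
  using per unfolding periodic_def by blast

text \<open>Heine-Cantor on a ball, carried over by periodicity: the lattice translation
  \<open>k\<close> moves \<open>x\<close> into radius 2, and the cap 1 on the distance keeps
  \<open>x'\<close> within radius 3.\<close>

lemma uniform_cont: "uniformly_continuous_on UNIV a"
  unfolding uniformly_continuous_on_def
proof (intro allI impI)
  fix e :: real assume "e > 0"
  have "uniformly_continuous_on (cball 0 3) a"
    by (intro compact_uniformly_continuous continuous_on_subset[OF cont]) auto
  then obtain d where d: "d > 0"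
    "\<And>x x'. x \<in> cball 0 3 \<Longrightarrow> x' \<in> cball 0 3 \<Longrightarrow> dist x' x < d \<Longrightarrow> dist (a x') (a x) < e"
    using \<open>e > 0\<close> unfolding uniformly_continuous_on_def by metis
  have "dist (a x') (a x) < e" if "dist x' x < min d 1" for x x'
  proof -
    define k :: "real^2" where "k = (\<chi> i. - of_int \<lfloor>x$i\<rfloor>)"
    have k: "k$i \<in> \<int>" for i by (simp add: k_def)
    have "\<bar>(x + k)$i\<bar> \<le> 1" for i
      using floor_correct[of "x$i"] by (simp add: k_def, linarith)
    from add_mono[OF this[of 1] this[of 2]] have "norm (x + k) \<le> 2"
      using norm_le_sum_abs_2[of "x + k"] by linarith
    moreover have "norm (x' + k) \<le> norm (x + k) + dist x' x"
      using norm_triangle_ineq[of "x + k" "x' - x"] by (simp add: dist_norm algebra_simps)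
    ultimately have "x + k \<in> cball 0 3" "x' + k \<in> cball 0 3"
      using that by auto
    then show ?thesis
      using d(2)[of "x + k" "x' + k"] that a_plus[OF k] by simp
  qed
  then show "\<exists>d>0. \<forall>x\<in>UNIV. \<forall>x'\<in>UNIV. dist x' x < d \<longrightarrow> dist (a x') (a x) < e"
    using d(1) by (intro exI[of _ "min d 1"]) auto
qed

lemma rotated_nonneg: "rotated \<theta> a x y \<ge> 0"
  by (simp add: rotated_def nonneg)

lemma continuous_rotated_pair: "continuous_on A (\<lambda>(x, y). rotated \<theta> a x y)"
  unfolding rotated_eq case_prod_unfold
  by (intro continuous_on_compose2[OF cont] continuous_intros) auto

lemma continuous_rotated: "continuous_on A (rotated \<theta> a x)"
  unfolding rotated_eq
  by (intro continuous_on_compose2[OF cont] continuous_intros) auto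

lemma integrable_rotated: "rotated \<theta> a x integrable_on {u..v}"
  by (intro integrable_continuous_real continuous_rotated)

lemma continuous_integral_rotated: "continuous_on A (\<lambda>x. integral {u..v} (rotated \<theta> a x))"
  using integral_continuous_on_param[of A u v "rotated \<theta> a"] continuous_rotated_pair by simp

lemma integrable_integral_rotated: "(\<lambda>x. integral {u..v} (rotated \<theta> a x)) integrable_on {r..s}"
  by (intro integrable_continuous_real continuous_integral_rotated)

text \<open>Since \<open>perp \<theta>\<close> is a unit vector, moving x moves the point by the
  same distance, so one modulus of continuity of \<open>a\<close> serves all directions. This makes
  a single threshold on T possible.\<close>

lemma rotated_equicontinuous:
  assumes "e > 0"
  obtains d where "d > 0"
    "\<And>\<theta> x x' y. norm \<theta> = 1 \<Longrightarrow> \<bar>x - x'\<bar> < d \<Longrightarrow> \<bar>rotated \<theta> a x y - rotated \<theta> a x' y\<bar> < e"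
proof -
  obtain d where d: "d > 0" "\<And>z z'. dist z' z < d \<Longrightarrow> dist (a z') (a z) < e"
    using uniform_cont assms unfolding uniformly_continuous_on_def by (metis UNIV_I)
  have "\<bar>rotated \<theta> a x y - rotated \<theta> a x' y\<bar> < e" if "norm \<theta> = 1" "\<bar>x - x'\<bar> < d" for \<theta> x x' y
  proof -
    have "dist (x *\<^sub>R perp \<theta> + y *\<^sub>R \<theta>) (x' *\<^sub>R perp \<theta> + y *\<^sub>R \<theta>) = norm ((x - x') *\<^sub>R perp \<theta>)"
      by (simp add: dist_norm algebra_simps)
    then show ?thesis
      using d(2)[of "x *\<^sub>R perp \<theta> + y *\<^sub>R \<theta>" "x' *\<^sub>R perp \<theta> + y *\<^sub>R \<theta>"] that
      by (simp add: rotated_eq dist_real_def)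
  qed
  then show ?thesis using that d(1) by blast
qed

text \<open>In rotated coordinates a lattice vector acts by its components across and along
  \<theta>. Both periods of a rational direction, T along and 1 / T across, come from this.\<close>

lemma rotated_translate:
  assumes "norm \<theta> = 1" "\<And>i. k$i \<in> \<int>"
  shows "rotated \<theta> a (x + k \<bullet> perp \<theta>) (y + k \<bullet> \<theta>) = rotated \<theta> a x y"
proof -
  have "(x + k \<bullet> perp \<theta>) *\<^sub>R perp \<theta> + (y + k \<bullet> \<theta>) *\<^sub>R \<theta> = (x *\<^sub>R perp \<theta> + y *\<^sub>R \<theta>) + k"
    by (subst perp_expansion[OF assms(1), of k, symmetric]) (simp add: scaleR_add_left)
  then show ?thesis
    using a_plus[OF assms(2)] by (simp add: rotated_eq)
qed

text \<open>A square of side 2, however rotated, contains a fixed part of a lattice translate of a ball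
  on which \<open>a\<close> is bounded below; hence the bound is uniform in the direction.\<close>

lemma square_lower_bound:
  obtains \<kappa> where "\<kappa> > 0"
    "\<And>\<theta> X Y. norm \<theta> = 1 \<Longrightarrow> integral {X..X+2} (\<lambda>x. integral {Y..Y+2} (rotated \<theta> a x)) \<ge> \<kappa>"
proof -
  obtain z0 where "a z0 \<noteq> 0" using nontrivial by blast
  define c where "c = a z0 / 2"
  have c: "c > 0" using \<open>a z0 \<noteq> 0\<close> nonneg[of z0] by (simp add: c_def)
  obtain d where d: "d > 0" "\<And>z. dist z z0 < d \<Longrightarrow> dist (a z) (a z0) < c"
    using cont c unfolding continuous_on_iff by (metis UNIV_I)
  \<comment> \<open>A point with both rotated coordinates within \<open>r\<close> of a centre has
    distance at most 2 * \<open>r\<close> < \<open>d\<close> from it; \<open>r\<close> \<le> 1/4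
    leaves room for a centre offset of 3/4 in a square of half-width 1.\<close>
  define r where "r = min (d / 3) (1 / 4)"
  have r: "r > 0" "r \<le> 1/4" "2 * r < d" using d(1) by (auto simp: r_def min_def)
  have ball: "a z \<ge> c" if "norm (z - z0) \<le> 2 * r" for z
    using d(2)[of z] that r by (auto simp: dist_norm abs_if c_def split: if_splits)
  have main: "integral {X..X+2} (\<lambda>x. integral {Y..Y+2} (rotated \<theta> a x)) \<ge> c * (2 * r) * (2 * r)"
    if \<theta>: "norm \<theta> = 1" for \<theta> X Y
  proof -
    \<comment> \<open>\<open>w\<close> is the centre of the square and \<open>k\<close> the rounding
      of \<open>w - z0\<close>. The coordinates of \<open>v\<close> are at most 1/2 in absolute
      value, so \<open>z0 + k\<close> lies within 3/4 of the centre, whatever the rotation.\<close>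
    define w where "w = (X + 1) *\<^sub>R perp \<theta> + (Y + 1) *\<^sub>R \<theta>"
    define k :: "real^2" where "k = (\<chi> i. of_int (round ((w - z0)$i)))"
    have k: "k$i \<in> \<int>" for i by (simp add: k_def)
    define v where "v = z0 + k - w"
    have "\<bar>v$i\<bar> \<le> 1/2" for i
      using of_int_round_abs_le[of "(w - z0)$i"] by (simp add: v_def k_def algebra_simps)
    then have "(v$i)\<^sup>2 \<le> (1/2)\<^sup>2" for i
      by (subst abs_le_square_iff[symmetric]) simp
    from add_mono[OF this[of 1] this[of 2]] have "(v$1)\<^sup>2 + (v$2)\<^sup>2 \<le> (3/4)\<^sup>2"
      by (simp add: power2_eq_square)
    then have "sqrt ((v$1)\<^sup>2 + (v$2)\<^sup>2) \<le> 3/4"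
      by (intro real_le_lsqrt) auto
    then have v: "norm v \<le> 3/4"
      by (simp add: norm_vec_def L2_set_def sum_2)
    define x0 where "x0 = X + 1 + v \<bullet> perp \<theta>"
    define y0 where "y0 = Y + 1 + v \<bullet> \<theta>"
    have "\<bar>v \<bullet> perp \<theta>\<bar> \<le> 3/4" "\<bar>v \<bullet> \<theta>\<bar> \<le> 3/4"
      using v Cauchy_Schwarz_ineq2[of v "perp \<theta>"] Cauchy_Schwarz_ineq2[of v \<theta>] \<theta> by auto
    then have loc: "X \<le> x0 - r" "x0 + r \<le> X + 2" "Y \<le> y0 - r" "y0 + r \<le> Y + 2"
      using r by (auto simp: x0_def y0_def)
    have z: "z0 + k = x0 *\<^sub>R perp \<theta> + y0 *\<^sub>R \<theta>"
    proof -
      have "z0 + k = w + v" by (simp add: v_def)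
      also have "\<dots> = w + ((v \<bullet> perp \<theta>) *\<^sub>R perp \<theta> + (v \<bullet> \<theta>) *\<^sub>R \<theta>)"
        by (simp add: perp_expansion[OF \<theta>])
      finally show ?thesis by (simp add: w_def x0_def y0_def scaleR_add_left)
    qed
    have pt: "rotated \<theta> a x y \<ge> c" if "x \<in> {x0 - r..x0 + r}" "y \<in> {y0 - r..y0 + r}" for x y
    proof -
      have "(x *\<^sub>R perp \<theta> + y *\<^sub>R \<theta> - k) - z0 = (x - x0) *\<^sub>R perp \<theta> + (y - y0) *\<^sub>R \<theta>"
        using z by (simp add: algebra_simps)
      also have "norm \<dots> \<le> \<bar>x - x0\<bar> + \<bar>y - y0\<bar>"
        using norm_triangle_ineq[of "(x - x0) *\<^sub>R perp \<theta>" "(y - y0) *\<^sub>R \<theta>"] \<theta> by simp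
      also have "\<dots> \<le> 2 * r" using that by auto
      finally have "a (x *\<^sub>R perp \<theta> + y *\<^sub>R \<theta> - k) \<ge> c" by (rule ball)
      then show ?thesis
        using a_plus[OF k, of "x *\<^sub>R perp \<theta> + y *\<^sub>R \<theta> - k"] by (simp add: rotated_eq)
    qed
    have inner: "integral {Y..Y+2} (rotated \<theta> a x) \<ge> c * (2 * r)" if "x \<in> {x0 - r..x0 + r}" for x
      using integral_subinterval_ge[OF continuous_rotated rotated_nonneg, of Y "y0 - r" "y0 + r" "Y + 2" c \<theta> x]
        loc r pt[OF that] by (simp add: algebra_simps)
    show ?thesis
      using integral_subinterval_ge[OF continuous_integral_rotated, of Y "Y + 2" \<theta> X "x0 - r" "x0 + r" "X + 2" "c * (2 * r)"]
        inner loc r by (simp add: Henstock_Kurzweil_Integration.integral_nonneg integrable_rotated rotated_nonneg algebra_simps)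
  qed
  show ?thesis
    by (rule that[of "c * (2 * r) * (2 * r)"]) (use c r main in auto)
qed

text \<open>The rectangle of width 2 and height 2 * n is cut along \<theta> into n squares of side
  2.\<close>

lemma stacked_squares_lower_bound:
  assumes \<kappa>: "\<And>X Y. integral {X..X+2} (\<lambda>x. integral {Y..Y+2} (rotated \<theta> a x)) \<ge> \<kappa>"
  shows "integral {X..X+2} (\<lambda>x. integral {Y..Y + 2 * real n} (rotated \<theta> a x)) \<ge> real n * \<kappa>"
proof (induction n)
  case (Suc n)
  let ?Z = "Y + 2 * real n"
  have "integral {Y..Y + 2 * real (Suc n)} (rotated \<theta> a x)
      = integral {Y..?Z} (rotated \<theta> a x) + integral {?Z..?Z + 2} (rotated \<theta> a x)" for x
    by (subst Henstock_Kurzweil_Integration.integral_combine) (auto intro: integrable_rotated simp: algebra_simps)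
  then have "integral {X..X+2} (\<lambda>x. integral {Y..Y + 2 * real (Suc n)} (rotated \<theta> a x))
     = integral {X..X+2} (\<lambda>x. integral {Y..?Z} (rotated \<theta> a x))
       + integral {X..X+2} (\<lambda>x. integral {?Z..?Z + 2} (rotated \<theta> a x))"
    by (simp add: Henstock_Kurzweil_Integration.integral_add integrable_integral_rotated)
  then show ?case
    using Suc \<kappa>[of X ?Z] by (simp add: algebra_simps)
qed auto

section \<open>Infima of averages along a direction\<close>

lemma dir_avg_eq:
  "dir_avg \<theta> M a x = (INF t. 1 / M * integral {t..t + M} (rotated \<theta> a x))"
  unfolding dir_avg_def by (simp add: LBINT_eq_integral[OF continuous_rotated])

lemma avg_bdd_below:
  "M > 0 \<Longrightarrow> bdd_below (range (\<lambda>t. 1 / M * integral {t..t + M} (rotated \<theta> a x)))"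
  by (intro bdd_belowI[of _ 0])
    (auto intro!: divide_nonneg_nonneg Henstock_Kurzweil_Integration.integral_nonneg integrable_rotated rotated_nonneg)

text \<open>Continuity of \<open>dir_avg\<close> is needed because the comb condition integrates it: the integral of a
  non-measurable function would be \<open>0\<close>.\<close>

lemma continuous_dir_avg:
  assumes \<theta>: "norm \<theta> = 1" and M: "M > 0"
  shows "continuous_on UNIV (dir_avg \<theta> M a)"
  unfolding continuous_on_iff
proof (intro ballI allI impI)
  fix x e :: real assume "e > 0"
  obtain d where d: "d > 0"
    "\<And>x x' y. \<bar>x - x'\<bar> < d \<Longrightarrow> \<bar>rotated \<theta> a x y - rotated \<theta> a x' y\<bar> < e / 2"
    using rotated_equicontinuous[of "e / 2"] \<open>e > 0\<close> \<theta> by (metis half_gt_zero)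
  \<comment> \<open>Each window average changes by at most e / 2, hence so does the infimum. The
    bound is one-sided but stated for arbitrary points, so it is applied both ways below.\<close>
  have le: "dir_avg \<theta> M a x - e / 2 \<le> dir_avg \<theta> M a x'" if "\<bar>x - x'\<bar> < d" for x x'
    unfolding dir_avg_eq[of \<theta> M x']
  proof (rule cINF_greatest)
    fix t
    have "integral {t..t + M} (rotated \<theta> a x) - M * (e / 2)
        = integral {t..t + M} (\<lambda>y. rotated \<theta> a x y - e / 2)"
      using M by (subst Henstock_Kurzweil_Integration.integral_diff) (auto intro: integrable_rotated)
    also have "\<dots> \<le> integral {t..t + M} (rotated \<theta> a x')"
    proof (rule integral_le)
      fix y show "rotated \<theta> a x y - e / 2 \<le> rotated \<theta> a x' y"
        using d(2)[OF that, of y] by linarith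
    qed (auto intro!: integrable_diff integrable_rotated)
    finally have "(integral {t..t + M} (rotated \<theta> a x) - M * (e / 2)) / M
        \<le> integral {t..t + M} (rotated \<theta> a x') / M"
      using M by (intro divide_right_mono) auto
    then have *: "1 / M * integral {t..t + M} (rotated \<theta> a x) - e / 2
        \<le> 1 / M * integral {t..t + M} (rotated \<theta> a x')"
      using M by (simp add: diff_divide_distrib)
    have "dir_avg \<theta> M a x \<le> 1 / M * integral {t..t + M} (rotated \<theta> a x)"
      unfolding dir_avg_eq by (intro cINF_lower avg_bdd_below M) auto
    with * show "dir_avg \<theta> M a x - e / 2 \<le> 1 / M * integral {t..t + M} (rotated \<theta> a x')" by simp
  qed auto
  show "\<exists>d>0. \<forall>x'\<in>UNIV. dist x' x < d \<longrightarrow> dist (dir_avg \<theta> M a x') (dir_avg \<theta> M a x) < e"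
  proof (intro exI conjI ballI impI)
    fix x' assume "dist x' x < d"
    then have "\<bar>x - x'\<bar> < d" "\<bar>x' - x\<bar> < d" by (auto simp: dist_real_def)
    from this[THEN le] show "dist (dir_avg \<theta> M a x') (dir_avg \<theta> M a x) < e"
      using \<open>e > 0\<close> unfolding dist_real_def by linarith
  qed (use d in auto)
qed

end

section \<open>Rational directions\<close>

lemma norm_vector_2: "norm (vector [x, y] :: real^2) = sqrt (x\<^sup>2 + y\<^sup>2)"
  by (simp add: norm_vec_def L2_set_def sum_2)

text \<open>As gcd 0 0 = 0, coprimality rules out the zero vector, and a nonzero integer sum of
  squares is at least 1.\<close>

lemma coprime_norm_ge_1:
  assumes "gcd P Q = (1 :: int)"
  shows "sqrt ((of_int P)\<^sup>2 + (of_int Q)\<^sup>2) \<ge> 1"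
proof -
  have "P\<^sup>2 + Q\<^sup>2 \<noteq> 0"
    using assms by (auto simp: sum_power2_eq_zero_iff)
  then have "P\<^sup>2 + Q\<^sup>2 \<ge> 1"
    using sum_power2_ge_zero[of P Q] by linarith
  then have "real_of_int (P\<^sup>2 + Q\<^sup>2) \<ge> 1" by linarith
  then show ?thesis by simp
qed

lemma norm_coprime_direction:
  assumes "gcd P Q = (1 :: int)" and T: "T = sqrt ((of_int P)\<^sup>2 + (of_int Q)\<^sup>2)"
  shows "norm ((1 / T) *\<^sub>R vector [of_int P, of_int Q] :: real^2) = 1"
  using coprime_norm_ge_1[OF assms(1)] by (simp add: norm_vector_2 flip: T)

locale rational_direction = periodic_density +
  fixes P Q :: int and T :: real and \<theta> :: "real^2"
  assumes coprime: "gcd P Q = 1"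
    and T_eq: "T = sqrt ((of_int P)\<^sup>2 + (of_int Q)\<^sup>2)"
    and \<theta>_eq: "\<theta> = (1 / T) *\<^sub>R vector [of_int P, of_int Q]"
begin

lemma T_ge_1: "T \<ge> 1"
  using coprime_norm_ge_1[OF coprime] by (simp add: T_eq)

lemma norm_\<theta>: "norm \<theta> = 1"
  using norm_coprime_direction[OF coprime T_eq] by (simp only: \<theta>_eq)

lemma T_sq: "T * T = of_int P * of_int P + of_int Q * of_int Q"
  by (simp add: T_eq flip: power2_eq_square)

text \<open>The lattice vector (P, Q) equals T times \<theta>: it shifts by T along \<theta> and by
  0 across.\<close>

lemma rotated_plus_T: "rotated \<theta> a x (y + T) = rotated \<theta> a x y"
proof -
  let ?k = "vector [of_int P, of_int Q] :: real^2"
  have k: "?k $ i \<in> \<int>" for i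
    using exhaust_2[of i] by auto
  have "?k \<bullet> perp \<theta> = 0" "?k \<bullet> \<theta> = T"
    using T_ge_1 T_sq by (auto simp: perp_def \<theta>_eq inner_vec_def sum_2 field_simps)
  then show ?thesis
    using rotated_translate[OF norm_\<theta> k, of x y] by simp
qed

text \<open>The function F of the overview: x labels a closed line of length T on the torus.\<close>

definition line_mass :: "real \<Rightarrow> real" where
  "line_mass x = integral {0..T} (rotated \<theta> a x)"

lemma integral_period: "integral {t..t+T} (rotated \<theta> a x) = line_mass x"
  unfolding line_mass_def
  using T_ge_1 by (intro integral_periodic continuous_rotated rotated_plus_T) auto

lemma line_mass_nonneg: "line_mass x \<ge> 0"
  unfolding line_mass_def
  by (intro Henstock_Kurzweil_Integration.integral_nonneg integrable_rotated rotated_nonneg)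

lemma continuous_line_mass: "continuous_on A line_mass"
  using continuous_integral_rotated[of A 0 T \<theta>] by (simp add: line_mass_def[abs_def])

lemma integrable_line_mass: "line_mass integrable_on {u..v}"
  by (intro integrable_continuous_real continuous_line_mass)

text \<open>By Bezout, the lattice points have all multiples of \<open>1 / T\<close> as coordinates across \<open>\<theta>\<close>.\<close>

lemma line_mass_plus: "line_mass (x + 1 / T) = line_mass x"
proof -
  obtain u v where uv: "u * P + v * Q = 1"
    using bezout_int[of P Q] coprime by metis
  \<comment> \<open>Its component across \<theta> is (u * P + v * Q) / T = 1 / T. The component
    \<open>?s\<close> along \<theta> only moves the window, which is a full period.\<close>
  let ?k = "vector [of_int v, - of_int u] :: real^2"
  have k: "?k $ i \<in> \<int>" for i
    using exhaust_2[of i] by auto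
  have "real_of_int (u * P + v * Q) = 1" by (simp add: uv)
  then have perp: "?k \<bullet> perp \<theta> = 1 / T"
    by (simp add: perp_def \<theta>_eq inner_vec_def sum_2 mult.commute flip: add_divide_distrib)
  let ?s = "?k \<bullet> \<theta>"
  have "line_mass (x + 1 / T) = integral {?s..?s + T} (rotated \<theta> a (x + 1 / T))"
    by (simp add: integral_period)
  also have "\<dots> = integral {0..T} (\<lambda>y. rotated \<theta> a (x + 1 / T) (y + ?s))"
    using integral_shift_real_ivl[of ?s ?s "?s + T" "rotated \<theta> a (x + 1 / T)"] by simp
  also have "\<dots> = line_mass x"
    using rotated_translate[OF norm_\<theta> k, of x] by (simp add: perp line_mass_def[abs_def])
  finally show ?thesis .
qed

text \<open>A window of length M \<ge> T contains a full period, and the density is nonnegative on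
  the rest.\<close>

lemma line_mass_le_avg:
  assumes "T \<le> M"
  shows "line_mass x / M \<le> dir_avg \<theta> M a x"
  unfolding dir_avg_eq
proof (rule cINF_greatest)
  fix t
  have "line_mass x \<le> integral {t..t + M} (rotated \<theta> a x)"
    unfolding integral_period[of t, symmetric] using assms
    by (intro integral_subset_le integrable_rotated) (auto simp: rotated_nonneg)
  then show "line_mass x / M \<le> 1 / M * integral {t..t + M} (rotated \<theta> a x)"
    using assms T_ge_1 by (simp add: divide_right_mono)
qed auto

text \<open>Reduces the comb condition to masses of strips of width L, by integrating
  \<open>line_mass_le_avg\<close> across \<theta>.\<close>

lemma comb_gcc_dirI:
  assumes M: "T \<le> M" and L: "L > 0"
    and mass: "\<And>x. integral {x..x + L} line_mass \<ge> \<eta> * L * M"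
  shows "comb_gcc_dir M L \<eta> \<theta> a"
  unfolding comb_gcc_dir_def relatively_dense_def
proof (rule cINF_greatest)
  fix x
  have M': "M > 0" using M T_ge_1 by simp
  have cont: "continuous_on A (dir_avg \<theta> M a)" for A
    using continuous_dir_avg[OF norm_\<theta> M'] continuous_on_subset by blast
  have "\<eta> * L \<le> integral {x..x + L} line_mass / M"
    using mass[of x] M' by (simp add: field_simps)
  also have "\<dots> = integral {x..x + L} (\<lambda>s. line_mass s / M)"
    by simp
  also have "\<dots> \<le> integral {x..x + L} (dir_avg \<theta> M a)"
    using M' line_mass_le_avg[OF M]
    by (intro integral_le integrable_continuous_real continuous_intros continuous_line_mass cont) auto
  finally show "\<eta> \<le> 1 / L * (LBINT s:{x..x + L}. dir_avg \<theta> M a s)"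
    using L by (simp add: LBINT_eq_integral[OF cont] field_simps)
qed auto

end

text \<open>The bound \<kappa> is a parameter, so every constant derived here is the same for all
  rational directions sharing \<kappa>.\<close>

locale massive_direction = rational_direction +
  fixes \<kappa> :: real
  assumes \<kappa>_pos: "\<kappa> > 0"
    and \<kappa>: "integral {X..X+2} (\<lambda>x. integral {Y..Y+2} (rotated \<theta> a x)) \<ge> \<kappa>"
begin

text \<open>Stack n = floor T squares along \<theta>. As T \<ge> 1, n \<ge> T / 2, so they carry at
  least \<kappa> T / 2; their height 2 n \<le> 2 T fits into two periods, which costs another factor
  2.\<close>

lemma integral_line_mass: "integral {X..X+2} line_mass \<ge> \<kappa> * T / 4"
proof -
  define n where "n = nat \<lfloor>T\<rfloor>"
  have n: "real n \<le> T" "T \<le> 2 * real n"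
  proof -
    have "1 \<le> \<lfloor>T\<rfloor>" using T_ge_1 by (simp add: le_floor_iff)
    then have "real n = of_int \<lfloor>T\<rfloor>" "1 \<le> real n" by (auto simp: n_def)
    then show "real n \<le> T" "T \<le> 2 * real n"
      using floor_correct[of T] by linarith+
  qed
  have "\<kappa> * T / 2 \<le> real n * \<kappa>"
    using n \<kappa>_pos by simp
  also have "\<dots> \<le> integral {X..X+2} (\<lambda>x. integral {0..0 + 2 * real n} (rotated \<theta> a x))"
    by (rule stacked_squares_lower_bound[OF \<kappa>])
  also have "\<dots> \<le> integral {X..X+2} (\<lambda>x. 2 * line_mass x)"
  proof (intro integral_le integrable_integral_rotated)
    fix x
    have "integral {0..0 + 2 * real n} (rotated \<theta> a x) \<le> integral {0..0 + real 2 * T} (rotated \<theta> a x)"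
      using n by (intro integral_subset_le integrable_rotated) (auto simp: rotated_nonneg)
    also have "\<dots> = 2 * line_mass x"
      using integral_periods[OF continuous_rotated rotated_plus_T, of 0 2 x] T_ge_1
      by (simp add: line_mass_def)
    finally show "integral {0..0 + 2 * real n} (rotated \<theta> a x) \<le> 2 * line_mass x" .
  qed (intro integrable_continuous_real continuous_intros continuous_line_mass)
  finally show ?thesis by simp
qed

text \<open>The width 2 does not depend on T, as the fixed L of the comb GCC requires. With 2 T + 4
  \<le> 6 T, the constant 48 gives exactly \<kappa> T / 4.\<close>

lemma comb_gcc_dir_2: "comb_gcc_dir (2 * T + 4) 2 (\<kappa> / 48) \<theta> a"
proof (rule comb_gcc_dirI)
  fix x
  have "\<kappa> * (2 * T + 4) \<le> \<kappa> * (6 * T)"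
    using T_ge_1 \<kappa>_pos by (intro mult_left_mono) auto
  then show "\<kappa> / 48 * 2 * (2 * T + 4) \<le> integral {x..x + 2} line_mass"
    using integral_line_mass[of x] by simp
qed (use T_ge_1 in auto)

text \<open>At most 3 T periods of length 1 / T cover a width of 2, so each carries at least
  \<kappa> / 12. The bound 2 T + 4 \<le> 6 T turns this into \<kappa> / 72.\<close>

lemma comb_gcc_dir_inverse: "comb_gcc_dir (2 * T + 4) (1 / T) (\<kappa> / 72) \<theta> a"
proof (rule comb_gcc_dirI)
  fix x
  define n where "n = nat \<lceil>2 * T\<rceil>"
  have n: "2 * T \<le> real n" "real n \<le> 3 * T"
    using T_ge_1 by (auto simp: n_def) linarith+
  define I where "I = integral {x..x + 1 / T} line_mass"
  have I: "I = integral {0..1 / T} line_mass"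
    unfolding I_def using T_ge_1 by (intro integral_periodic continuous_line_mass line_mass_plus) auto
  have "I \<ge> 0"
    unfolding I_def
    by (intro Henstock_Kurzweil_Integration.integral_nonneg integrable_line_mass line_mass_nonneg)
  have "\<kappa> * T / 4 \<le> integral {x..x + 2} line_mass"
    by (rule integral_line_mass)
  also have "\<dots> \<le> integral {x..x + real n * (1 / T)} line_mass"
    using n T_ge_1 by (intro integral_subset_le integrable_line_mass)
      (auto simp: line_mass_nonneg field_simps)
  also have "\<dots> = real n * I"
    unfolding I using T_ge_1 by (intro integral_periods continuous_line_mass line_mass_plus) auto
  also have "\<dots> \<le> 3 * T * I"
    using n \<open>I \<ge> 0\<close> by (intro mult_right_mono) auto
  finally have "\<kappa> / 12 \<le> I"
    using T_ge_1 by (simp add: field_simps)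
  moreover have "\<kappa> * (2 * T + 4) \<le> \<kappa> * (6 * T)"
    using T_ge_1 \<kappa>_pos by (intro mult_left_mono) auto
  then have "\<kappa> / 72 * (1 / T) * (2 * T + 4) \<le> \<kappa> / 12"
    using T_ge_1 by (simp add: field_simps)
  ultimately show "\<kappa> / 72 * (1 / T) * (2 * T + 4) \<le> integral {x..x + 1 / T} line_mass"
    by (simp add: I_def)
qed (use T_ge_1 in auto)

text \<open>For large \<open>T\<close> the period \<open>1 / T\<close> of \<open>line_mass\<close> is below the modulus of continuity, so
  \<open>line_mass\<close> is nearly constant and hence everywhere close to its average.\<close>

lemma gcc_if_large:
  assumes d: "\<And>x x' y. \<bar>x - x'\<bar> < d \<Longrightarrow> \<bar>rotated \<theta> a x y - rotated \<theta> a x' y\<bar> < \<kappa> / 16"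
    and T: "1 / T < d"
  shows "gcc (T + 2) (\<kappa> / 48) \<theta> a"
  unfolding gcc_def
proof
  fix x
  interpret periodic_fun_simple line_mass "1 / T"
    by standard (rule line_mass_plus)
  have le: "line_mass x' \<le> line_mass x + T * (\<kappa> / 16)" for x'
  proof -
    \<comment> \<open>The translate of \<open>x'\<close> by a multiple of 1 / T that lands in
      [x, x + 1 / T].\<close>
    define x'' where "x'' = x' - of_int \<lfloor>(x' - x) * T\<rfloor> * (1 / T)"
    have "(x'' - x) * T = (x' - x) * T - of_int \<lfloor>(x' - x) * T\<rfloor>"
      using T_ge_1 by (simp add: x''_def field_simps)
    then have "0 \<le> (x'' - x) * T" "(x'' - x) * T \<le> 1"
      using floor_correct[of "(x' - x) * T"] by linarith+
    then have "0 \<le> x'' - x" "x'' - x \<le> 1 / T"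
      using T_ge_1 by (auto simp: field_simps zero_le_mult_iff)
    then have close: "\<bar>x'' - x\<bar> < d" using T by simp
    have "line_mass x' = line_mass x''"
      unfolding x''_def by (rule minus_of_int[symmetric])
    also have "\<dots> \<le> integral {0..T} (\<lambda>y. rotated \<theta> a x y + \<kappa> / 16)"
      unfolding line_mass_def
    proof (rule integral_le)
      fix y show "rotated \<theta> a x'' y \<le> rotated \<theta> a x y + \<kappa> / 16"
        using d[OF close, of y] by linarith
    qed (auto intro!: integrable_add integrable_rotated)
    also have "\<dots> = line_mass x + T * (\<kappa> / 16)"
      unfolding line_mass_def using T_ge_1
      by (subst Henstock_Kurzweil_Integration.integral_add) (auto intro: integrable_rotated)
    finally show ?thesis .
  qed
  \<comment> \<open>Averaging over width 2 leaves \<kappa> T / 8 \<le> \<open>line_mass x\<close> +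
    \<kappa> T / 16; the tolerance \<kappa> / 16 thus gives up half of the mean.\<close>
  have "\<kappa> * T / 4 \<le> integral {0..0+2::real} line_mass"
    by (rule integral_line_mass)
  also have "\<dots> \<le> integral {0..0+2::real} (\<lambda>_. line_mass x + T * (\<kappa> / 16))"
    using le by (intro integral_le integrable_line_mass) auto
  finally have mass: "\<kappa> * T / 16 \<le> line_mass x" by (simp add: mult.commute)
  have "\<kappa> * (T + 2) \<le> \<kappa> * (3 * T)"
    using T_ge_1 \<kappa>_pos by (intro mult_left_mono) auto
  with mass have "\<kappa> / 48 \<le> line_mass x / (T + 2)"
    using T_ge_1 by (simp add: field_simps)
  also have "\<dots> \<le> dir_avg \<theta> (T + 2) a x"
    by (rule line_mass_le_avg) simp
  finally show "\<kappa> / 48 \<le> dir_avg \<theta> (T + 2) a x" .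
qed

end

section \<open>Covering the circle by rational directions\<close>

text \<open>Scale \<open>u - v\<close> by 1 / \<open>norm v\<close> and then correct the length of
  \<open>u\<close>; each contribution is at most \<open>norm (u - v) / norm v\<close>.\<close>

lemma norm_sgn_diff_le:
  fixes u v :: "'a::real_normed_vector"
  assumes "u \<noteq> 0" "v \<noteq> 0"
  shows "norm (sgn u - sgn v) \<le> 2 * norm (u - v) / norm v"
proof -
  have "sgn u - sgn v = (1 / norm v) *\<^sub>R (u - v) + ((norm v - norm u) / (norm u * norm v)) *\<^sub>R u"
  proof -
    have "(norm v - norm u) / (norm u * norm v) = inverse (norm u) - inverse (norm v)"
      using assms by (simp add: field_simps)
    then show ?thesis
      by (simp add: sgn_div_norm scaleR_diff_left scaleR_diff_right divide_inverse)
  qed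
  also have "norm \<dots> \<le> norm (u - v) / norm v + \<bar>norm v - norm u\<bar> / norm v"
    using assms by (intro norm_triangle_le) (simp add: abs_mult)
  also have "\<dots> \<le> norm (u - v) / norm v + norm (u - v) / norm v"
    using norm_triangle_ineq3[of v u] by (intro add_left_mono divide_right_mono) (auto simp: norm_minus_commute)
  finally show ?thesis by simp
qed

text \<open>Dirichlet approximation of y / x by h / k. The slope is at most 1 in absolute value, so
  |h| \<le> k + 1 and k + |h| \<le> 2 N + 1 \<le> 3 N.\<close>

lemma dirichlet_slope:
  fixes x y :: real and N :: nat
  assumes "\<bar>y\<bar> \<le> \<bar>x\<bar>" "x \<noteq> 0" "N > 0"
  obtains P Q :: int and c :: real
    where "gcd P Q = 1" "c > 0" "c * x = of_int P" "\<bar>c * y - of_int Q\<bar> \<le> 1 / N"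
      "\<bar>of_int P\<bar> + \<bar>of_int Q\<bar> \<le> (3 * N :: real)"
proof -
  obtain h k where hk: "coprime h k" "0 < k" "k \<le> int N" "\<bar>of_int k * (y / x) - of_int h\<bar> < 1 / N"
    using Dirichlet_approx_coprime[OF \<open>N > 0\<close>] by blast
  \<comment> \<open>An oriented direction has to be matched, not only its slope: the sign of
    \<open>x\<close> is passed on to (k, h), and the scale c = k / |x| stays positive.\<close>
  define s :: int where "s = (if x > 0 then 1 else -1)"
  have s: "s = 1 \<or> s = -1"
    by (simp add: s_def)
  define z where "z = of_int k * (y / x)"
  have "\<bar>z\<bar> \<le> of_int k * 1"
    unfolding z_def abs_mult using assms hk by (intro mult_mono) (auto simp: field_simps)
  moreover have "1 / real N \<le> 1" using assms by simp
  ultimately have "\<bar>of_int h\<bar> \<le> of_int k + (1::real)" using hk(4)[folded z_def] by linarith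
  moreover have "real_of_int k \<ge> 1" "real_of_int k \<le> N" using hk by linarith+
  ultimately have "\<bar>of_int k\<bar> + \<bar>of_int h\<bar> \<le> (3 * N :: real)" by linarith
  then have size: "\<bar>of_int (s * k)\<bar> + \<bar>of_int (s * h)\<bar> \<le> (3 * N :: real)"
    using s by auto
  have cop: "gcd (s * k) (s * h) = 1"
    using s hk(1) by (auto simp: coprime_iff_gcd_eq_1 gcd.commute)
  have first: "of_int k / \<bar>x\<bar> * x = of_int (s * k)"
    using assms by (auto simp: s_def)
  have "of_int k / \<bar>x\<bar> * y - of_int (s * h) = of_int s * (of_int k * (y / x) - of_int h)"
    using assms by (auto simp: s_def field_simps)
  then have second: "\<bar>of_int k / \<bar>x\<bar> * y - of_int (s * h)\<bar> \<le> 1 / N"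
    using hk(4) s by (auto simp: abs_mult)
  have "of_int k / \<bar>x\<bar> > 0"
    using hk(2) assms by simp
  from that[OF cop this first second size] show ?thesis .
qed

text \<open>The coordinate of larger absolute value serves as denominator. A positive multiple of
  \<phi> is then within 1 / N of (P, Q), and normalising both vectors gives 2 / (N T).\<close>

lemma dirichlet_direction:
  fixes \<phi> :: "real^2" and N :: nat
  assumes \<phi>: "norm \<phi> = 1" and N: "N > 0"
  obtains P Q :: int and T :: real
    where "gcd P Q = 1" "T = sqrt ((of_int P)\<^sup>2 + (of_int Q)\<^sup>2)" "T \<le> 3 * N"
      "norm (\<phi> - (1 / T) *\<^sub>R vector [of_int P, of_int Q]) \<le> 2 / (N * T)"
proof -
  have "\<phi> \<noteq> 0" using \<phi> by auto
  then have nz: "\<phi>$1 \<noteq> 0 \<or> \<phi>$2 \<noteq> 0"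
    by (auto simp: vec_eq_iff forall_2)
  obtain P Q :: int and c :: real where PQ: "gcd P Q = 1" "c > 0"
      "\<bar>c * \<phi>$1 - of_int P\<bar> + \<bar>c * \<phi>$2 - of_int Q\<bar> \<le> 1 / N"
      "\<bar>of_int P\<bar> + \<bar>of_int Q\<bar> \<le> (3 * N :: real)"
  proof (cases "\<bar>\<phi>$2\<bar> \<le> \<bar>\<phi>$1\<bar>")
    case True
    then have "\<phi>$1 \<noteq> 0" using nz by auto
    from dirichlet_slope[OF True this N] show ?thesis using that
      by (metis abs_zero add_0 diff_self)
  next
    case False
    then have "\<bar>\<phi>$1\<bar> \<le> \<bar>\<phi>$2\<bar>" "\<phi>$2 \<noteq> 0" using nz by auto
    from dirichlet_slope[OF this N] show ?thesis using that
      by (metis abs_zero add_0 add.commute diff_self gcd.commute)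
  qed
  let ?v = "vector [of_int P, of_int Q] :: real^2"
  define T where "T = sqrt ((of_int P)\<^sup>2 + (of_int Q :: real)\<^sup>2)"
  have T: "T = norm ?v" "T \<ge> 1"
    using coprime_norm_ge_1[OF PQ(1)] by (auto simp: T_def norm_vector_2)
  have "norm (c *\<^sub>R \<phi> - ?v) \<le> 1 / N"
    using norm_le_sum_abs_2[of "c *\<^sub>R \<phi> - ?v"] PQ(3) by simp
  moreover have "sgn (c *\<^sub>R \<phi>) = \<phi>" "sgn ?v = (1 / T) *\<^sub>R ?v"
    using PQ(2) \<phi> T by (auto simp: sgn_div_norm divide_inverse)
  moreover have "norm (sgn (c *\<^sub>R \<phi>) - sgn ?v) \<le> 2 * norm (c *\<^sub>R \<phi> - ?v) / norm ?v"
    using \<open>\<phi> \<noteq> 0\<close> PQ(2) T by (intro norm_sgn_diff_le) auto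
  moreover have "2 * norm (c *\<^sub>R \<phi> - ?v) / T \<le> 2 * (1 / N) / T"
    using \<open>norm (c *\<^sub>R \<phi> - ?v) \<le> 1 / N\<close> T by (intro divide_right_mono mult_left_mono) auto
  ultimately have "norm (\<phi> - (1 / T) *\<^sub>R ?v) \<le> 2 / (N * T)"
    using T by simp
  moreover have "T \<le> 3 * N"
    using norm_le_sum_abs_2[of ?v] PQ(4) T by simp
  ultimately show ?thesis
    using that[OF PQ(1) T_def] by blast
qed

text \<open>Allows T to be treated as a function of the direction. Parallel coprime vectors satisfy
  P Q' = P' Q, which determines the entries up to sign.\<close>

lemma coprime_direction_inj:
  fixes P Q P' Q' :: int
  assumes cop: "gcd P Q = 1" "gcd P' Q' = 1"
    and T: "T = sqrt ((of_int P)\<^sup>2 + (of_int Q)\<^sup>2)" "T' = sqrt ((of_int P')\<^sup>2 + (of_int Q')\<^sup>2)"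
    and eq: "(1 / T) *\<^sub>R vector [of_int P, of_int Q]
      = ((1 / T') *\<^sub>R vector [of_int P', of_int Q'] :: real^2)"
  shows "T = T'"
proof -
  have pos: "T \<ge> 1" "T' \<ge> 1" using cop T coprime_norm_ge_1 by auto
  have e: "of_int P * T' = of_int P' * T" "of_int Q * T' = of_int Q' * T"
    using eq pos by (auto simp: vec_eq_iff forall_2 field_simps)
  have "(of_int P * T') * (of_int Q' * T) = (of_int P' * T) * (of_int Q * T')"
    by (simp only: e)
  then have "real_of_int (P * Q') = of_int (P' * Q)"
    using pos by simp
  then have "P * Q' = P' * Q" by linarith
  then have "\<bar>P\<bar> * \<bar>Q'\<bar> = \<bar>P'\<bar> * \<bar>Q\<bar>" by (metis abs_mult)
  then have "\<bar>P\<bar> = \<bar>P'\<bar>" "\<bar>Q'\<bar> = \<bar>Q\<bar>"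
    using coprime_crossproduct_int[of P Q P' Q'] cop by (auto simp: coprime_iff_gcd_eq_1)
  then have "\<bar>real_of_int P\<bar> = \<bar>real_of_int P'\<bar>" "\<bar>real_of_int Q\<bar> = \<bar>real_of_int Q'\<bar>"
    by (metis of_int_abs)+
  then show ?thesis
    unfolding T by (metis power2_abs)
qed

text \<open>The covering consists of all rational directions with T \<le> 3 N, arc widths 2 / (N T)
  and lengths 2 T + 4. Each of the two summands to be bounded is made smaller than \<rho> /
  2.\<close>

lemma comb_gcc_if_rational_directions:
  fixes \<eta> :: real
  assumes \<eta>: "\<eta> > 0"
    and comb: "\<And>P Q T. gcd P Q = 1 \<Longrightarrow> T = sqrt ((of_int P)\<^sup>2 + (of_int Q)\<^sup>2) \<Longrightarrow>
      comb_gcc_dir (2 * T + 4) 2 \<eta> ((1 / T) *\<^sub>R vector [of_int P, of_int Q]) a"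
  shows "comb_gcc a"
  unfolding comb_gcc_def
proof (rule exI[of _ 2], rule conjI[rotated], rule exI[of _ \<eta>], rule conjI[OF \<eta>], intro allI impI)
  fix \<rho> :: real assume \<rho>: "\<rho> > 0"
  \<comment> \<open>Chosen so that 12 / N < \<rho> / 2, which will bound width times length.\<close>
  obtain N :: nat where N: "24 / \<rho> < N" using reals_Archimedean2 by blast
  with \<rho> have N0: "N > 0" by (metis divide_pos_pos less_trans of_nat_0_less_iff zero_less_numeral)
  \<comment> \<open>The inverse term is at most 3 N^2 / (2 \<open>lam\<close>); the added 1 gives
    both \<open>lam0\<close> \<ge> 1 and a strict bound by \<rho> / 2.\<close>
  define lam0 where "lam0 = 1 + 3 * (real N)\<^sup>2 / \<rho>"
  show "\<exists>lam0\<ge>1. \<forall>lam\<ge>lam0. effective_covering 2 \<eta> \<rho> lam a"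
  proof (rule exI[of _ lam0], intro conjI allI impI)
    show "lam0 \<ge> 1" using \<rho> by (simp add: lam0_def)
    fix lam assume lam: "lam \<ge> lam0"
    \<comment> \<open>Widths and lengths must be functions of \<theta>, so T is recovered from
      \<theta> by a definite description, legitimate by
      \<open>coprime_direction_inj\<close>.\<close>
    define rep where "rep \<theta> T \<longleftrightarrow> T \<le> 3 * N \<and> (\<exists>P Q. gcd P Q = 1 \<and>
        T = sqrt ((of_int P)\<^sup>2 + (of_int Q)\<^sup>2) \<and> \<theta> = (1 / T) *\<^sub>R vector [of_int P, of_int Q])"
      for \<theta> :: "real^2" and T :: real
    define \<Theta> where "\<Theta> = {\<theta>. \<exists>T. rep \<theta> T}"
    define \<tau> where "\<tau> \<theta> = (THE T. rep \<theta> T)" for \<theta>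
    have \<tau>_eq: "\<tau> \<theta> = T" if "rep \<theta> T" for \<theta> T
      unfolding \<tau>_def
    proof (rule the_equality[where P = "rep \<theta>", OF that])
      fix T' assume "rep \<theta> T'"
      then show "T' = T"
        using that coprime_direction_inj unfolding rep_def by metis
    qed
    then have rep: "rep \<theta> (\<tau> \<theta>)" if "\<theta> \<in> \<Theta>" for \<theta>
      using that by (auto simp: \<Theta>_def)
    then have \<tau>1: "\<tau> \<theta> \<ge> 1" if "\<theta> \<in> \<Theta>" for \<theta>
      using coprime_norm_ge_1 that unfolding rep_def by metis
    have \<tau>_le: "\<tau> \<theta> \<le> 3 * N" if "\<theta> \<in> \<Theta>" for \<theta>
      using rep[OF that] by (simp add: rep_def)
    define \<epsilon> where "\<epsilon> \<theta> = 2 / (N * \<tau> \<theta>)" for \<theta>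
    show "effective_covering 2 \<eta> \<rho> lam a"
      unfolding effective_covering_def
    proof (rule exI[of _ \<Theta>], rule conjI[rotated], rule exI[of _ \<epsilon>],
        rule exI[of _ "\<lambda>\<theta>. 2 * \<tau> \<theta> + 4"], intro conjI ballI)
      show "\<Theta> \<subseteq> sphere 0 1"
      proof
        fix \<theta> assume "\<theta> \<in> \<Theta>"
        from rep[OF this] show "\<theta> \<in> sphere 0 1"
          unfolding rep_def using norm_coprime_direction by auto
      qed
      show "sphere 0 1 \<subseteq> (\<Union>\<theta>\<in>\<Theta>. {\<phi> \<in> sphere 0 1. norm (\<phi> - \<theta>) \<le> \<epsilon> \<theta>})"
      proof
        fix \<phi> :: "real^2" assume \<phi>: "\<phi> \<in> sphere 0 1"
        then have "norm \<phi> = 1" by simp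
        then obtain P Q :: int and T :: real where PQ: "gcd P Q = 1" "T = sqrt ((of_int P)\<^sup>2 + (of_int Q)\<^sup>2)" "T \<le> 3 * N"
          "norm (\<phi> - (1 / T) *\<^sub>R vector [of_int P, of_int Q]) \<le> 2 / (N * T)"
          using N0 by (rule dirichlet_direction)
        let ?\<theta> = "(1 / T) *\<^sub>R vector [of_int P, of_int Q] :: real^2"
        have r: "rep ?\<theta> T"
          unfolding rep_def by (intro conjI exI[of _ P] exI[of _ Q] PQ refl)
        then have "?\<theta> \<in> \<Theta>"
          unfolding \<Theta>_def by blast
        moreover have "norm (\<phi> - ?\<theta>) \<le> \<epsilon> ?\<theta>"
          unfolding \<epsilon>_def \<tau>_eq[OF r] by (rule PQ(4))
        ultimately show "\<phi> \<in> (\<Union>\<theta>\<in>\<Theta>. {\<phi> \<in> sphere 0 1. norm (\<phi> - \<theta>) \<le> \<epsilon> \<theta>})"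
          using \<phi> by blast
      qed
      fix \<theta> assume \<theta>: "\<theta> \<in> \<Theta>"
      show "\<epsilon> \<theta> > 0" "2 * \<tau> \<theta> + 4 > 0"
        using \<tau>1[OF \<theta>] N0 by (auto simp: \<epsilon>_def)
      show "comb_gcc_dir (2 * \<tau> \<theta> + 4) 2 \<eta> \<theta> a"
        using rep[OF \<theta>] comb unfolding rep_def by metis
      \<comment> \<open>Narrow arcs compensate long windows: \<epsilon> times \<tau> is 2 / N for
        every direction.\<close>
      have "\<epsilon> \<theta> * (2 * \<tau> \<theta> + 4) \<le> \<epsilon> \<theta> * (6 * \<tau> \<theta>)"
        using \<tau>1[OF \<theta>] \<open>\<epsilon> \<theta> > 0\<close> by (intro mult_left_mono) auto
      also have "\<dots> = 12 / N"
        using \<tau>1[OF \<theta>] by (simp add: \<epsilon>_def)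
      also have "\<dots> < \<rho> / 2"
        using N N0 \<rho> by (simp add: field_simps)
      finally have 1: "\<epsilon> \<theta> * (2 * \<tau> \<theta> + 4) < \<rho> / 2" .
      have lam_pos: "lam > 3 * (real N)\<^sup>2 / \<rho>" "lam > 0"
        using lam \<open>lam0 \<ge> 1\<close> by (auto simp: lam0_def)
      have "inverse (\<epsilon> \<theta> * lam) = N * \<tau> \<theta> / (2 * lam)"
        by (simp add: \<epsilon>_def field_simps)
      also have "\<dots> \<le> real N * (3 * real N) / (2 * lam)"
        using \<tau>_le[OF \<theta>] lam_pos by (intro divide_right_mono mult_left_mono) auto
      also have "\<dots> < \<rho> / 2"
        using lam_pos \<rho> by (simp add: field_simps power2_eq_square)
      finally show "\<epsilon> \<theta> * (2 * \<tau> \<theta> + 4) + inverse (\<epsilon> \<theta> * lam) < \<rho>"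
        using 1 by simp
    qed
  qed
qed simp

section \<open>Constants common to all rational directions\<close>

theorem proposition4p10:
  fixes a :: "real^2 \<Rightarrow> real"
  assumes "continuous_on UNIV a"
    and "\<forall>z. a z \<in> {0..1}"
    and "\<exists>z. a z \<noteq> 0"
    and "periodic a"
  shows "comb_gcc a \<and>
    (\<exists>\<eta>>0. \<exists>T0>0. \<forall>P Q :: int. \<forall>T :: real. \<forall>\<theta> :: real^2.
       gcd P Q = 1 \<longrightarrow>
       T = sqrt ((of_int P)\<^sup>2 + (of_int Q)\<^sup>2) \<longrightarrow>
       \<theta> = (1 / T) *\<^sub>R vector [of_int P, of_int Q] \<longrightarrow>
         (T \<ge> T0 \<longrightarrow> gcc (T + 2) \<eta> \<theta> a) \<and>
         (T < T0 \<longrightarrow> comb_gcc_dir (2 * T + 4) (1 / T) \<eta> \<theta> a))"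
proof -
  interpret periodic_density a
    using assms by unfold_locales auto
  obtain \<kappa> where \<kappa>: "\<kappa> > 0"
    "\<And>\<theta> X Y. norm \<theta> = 1 \<Longrightarrow> integral {X..X+2} (\<lambda>x. integral {Y..Y+2} (rotated \<theta> a x)) \<ge> \<kappa>"
    using square_lower_bound by blast
  \<comment> \<open>The first locale provides the unit norm needed to specialise the uniform bound
    \<kappa> to this direction.\<close>
  have dir: "massive_direction a P Q T \<theta> \<kappa>"
    if "gcd P Q = 1" "T = sqrt ((of_int P)\<^sup>2 + (of_int Q)\<^sup>2)"
      "\<theta> = (1 / T) *\<^sub>R vector [of_int P, of_int Q]" for P Q T \<theta>
  proof -
    interpret rational_direction a P Q T \<theta>
      using that by unfold_locales
    show ?thesis
      using \<kappa> norm_\<theta> by unfold_locales auto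
  qed
  \<comment> \<open>The threshold will be T0 = 2 / d: then 1 / T \<le> d / 2, strictly below
    d.\<close>
  obtain d where d: "d > 0"
    "\<And>\<theta> x x' y. norm \<theta> = 1 \<Longrightarrow> \<bar>x - x'\<bar> < d \<Longrightarrow> \<bar>rotated \<theta> a x y - rotated \<theta> a x' y\<bar> < \<kappa> / 16"
    using rotated_equicontinuous[of "\<kappa> / 16"] \<kappa>(1) by (metis divide_pos_pos zero_less_numeral)
  have small: "comb_gcc_dir (2 * T + 4) (1 / T) (\<kappa> / 72) \<theta> a"
    and comb: "comb_gcc_dir (2 * T + 4) 2 (\<kappa> / 48) \<theta> a"
    and large: "T \<ge> 2 / d \<Longrightarrow> gcc (T + 2) (\<kappa> / 72) \<theta> a"
    if "gcd P Q = 1" "T = sqrt ((of_int P)\<^sup>2 + (of_int Q)\<^sup>2)"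
      "\<theta> = (1 / T) *\<^sub>R vector [of_int P, of_int Q]" for P Q T \<theta>
  proof -
    interpret massive_direction a P Q T \<theta> \<kappa>
      using that by (rule dir)
    show "comb_gcc_dir (2 * T + 4) (1 / T) (\<kappa> / 72) \<theta> a" "comb_gcc_dir (2 * T + 4) 2 (\<kappa> / 48) \<theta> a"
      by (fact comb_gcc_dir_inverse comb_gcc_dir_2)+
    assume "T \<ge> 2 / d"
    then have "1 / T < d"
      using d(1) T_ge_1 by (simp add: field_simps)
    then have "gcc (T + 2) (\<kappa> / 48) \<theta> a"
      using d(2)[OF norm_\<theta>] by (intro gcc_if_large)
    \<comment> \<open>One \<eta> has to serve both claims, so the smaller constant \<kappa> / 72 is
      used.\<close>
    moreover have "\<kappa> / 72 \<le> \<kappa> / 48" using \<kappa>_pos by simp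
    ultimately show "gcc (T + 2) (\<kappa> / 72) \<theta> a"
      unfolding gcc_def by (blast intro: order_trans)
  qed
  have "comb_gcc a"
    by (rule comb_gcc_if_rational_directions[of "\<kappa> / 48"]) (use \<kappa>(1) comb in auto)
  moreover have "\<kappa> / 72 > 0" "2 / d > 0"
    using \<kappa>(1) d(1) by auto
  ultimately show ?thesis
    by (intro conjI exI[of _ "\<kappa> / 72"] exI[of _ "2 / d"] allI impI small large)
qed

end
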